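(* Consider the plant $x_{k+1}=A_px_k+B_pu_k$, $y_k=C_px_k$ with $x_k\in\mathbb{R}^n$, $u_k\in\mathbb{R}^m$, $y_k\in\mathbb{R}^p$, in feedback with the (possibly biased) static implicit controller $$\eta_k=\phi(W\eta_k+Uy_k+b),\qquad u_k=Ky_k+V\eta_k+d,\qquad \eta_k\in\mathbb{R}^q.$$ Let $(x_\star,\eta_\star,z_\star,u_\star)$ be an equilibrium, i.e. $x_\star=A_px_\star+B_pu_\star$, $y_\star=C_px_\star$, $z_\star=W\eta_\star+Uy_\star+b$, $\eta_\star=\phi(z_\star)$, $u_\star=Ky_\star+V\eta_\star+d$. Suppose that $\phi$ is componentwise nonexpansive, that $\phi$ satisfies the incremental sector condition with diagonal matrices $D_0,D_1$, and that $\lambda_{\mathrm{pf}}(|W|)<1$. (i) If there exist $P\succ0$, a diagonal $\Lambda\succeq0$, and $\rho\in[0,1)$ such that $F^\top PF-\rho^2X^\top PX+M_\Lambda\preceq0$, then $x_\star$ is globally exponentially stable for the closed loop: every trajectory satisfies $(x_k-x_\star)^\top P(x_k-x_\star)\le\rho^{2k}(x_0-x_\star)^\top P(x_0-x_\star)$ for all $k\ge0$. (ii) Let $Q\succeq0$, $R\succeq0$, $\beta\in(0,1]$. If there exist $P\succ0$ and a diagonal $\Lambda\succeq0$ such that $\beta F^\top PF-X^\top PX+X^\top QX+G^\top RG+M_\Lambda\preceq0$, then every trajectory satisfies, with $\tilde x_k=x_k-x_\star$ and $\tilde u_k=u_k-u_\star$, $$\sum_{k=0}^\infty\beta^k\left(\tilde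 x_k^\top Q\tilde x_k+\tilde u_k^\top R\tilde u_k\right)\le\tilde x_0^\top P\tilde x_0.$$
   Context: Componentwise nonexpansive: $\phi:\mathbb{R}^q\to\mathbb{R}^q$ acts componentwise, $\phi(r)_i=\phi_i(r_i)$, and $|\phi(r)-\phi(s)|\le|r-s|$ for all $r,s$, with componentwise absolute values and inequalities. Incremental sector condition: there are diagonal matrices $D_0=\mathrm{diag}(\underline m_i)$, $D_1=\mathrm{diag}(\overline m_i)$ with $0\le\underline m_i\le\overline m_i\le1$ such that for all $r,s\in\mathbb{R}^q$ and $i=1,\dots,q$, $$\big(\phi_i(r_i)-\phi_i(s_i)-\underline m_i(r_i-s_i)\big)\big(\overline m_i(r_i-s_i)-\phi_i(r_i)+\phi_i(s_i)\big)\ge0.$$ Notation: $X=[I_n\;\;0]\in\mathbb{R}^{n\times(n+q)}$, $H=[0\;\;I_q]\in\mathbb{R}^{q\times(n+q)}$, $Z=[UC_p\;\;W]$, $F=[A_p+B_pKC_p\;\;B_pV]$, $G=[KC_p\;\;V]$, and $$M_\Lambda=-2Z^\top D_0\Lambda D_1Z+\mathrm{He}\big(H^\top\Lambda(D_0+D_1)Z\big)-2H^\top\Lambda H,$$ where $\mathrm{He}(Y)=Y+Y^\top$. $P\in\mathbb{R}^{n\times n}$, $\Lambda\in\mathbb{R}^{q\times q}$; $P\succ0$ means symmetric positive definite; $\preceq,\succeq$ denote the semidefinite order. $|W|$ is the componentwise absolute value and $\lambda_{\mathrm{pf}}(|W|)$ is the Perron--Frobenius eigenvalue (spectral radius) of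 the nonnegative matrix $|W|$. All matrices are real of compatible dimensions. At each time, $\eta_k$ is the (unique) solution of the algebraic fixed-point equation for the current $y_k$. *)

theory Defs
  imports "HOL-Analysis.Analysis"
begin

section \<open>Matrices\<close>

definition hcat :: "real ^ 'a ^ 'r \<Rightarrow> real ^ 'b ^ 'r \<Rightarrow> real ^ ('a + 'b) ^ 'r"
  where "hcat A B = (\<chi> i j. case j of Inl a \<Rightarrow> A $ i $ a | Inr b \<Rightarrow> B $ i $ b)"

definition He :: "real ^ 'a ^ 'a \<Rightarrow> real ^ 'a ^ 'a"
  where "He Y = Y + transpose Y"

definition diagonal_matrix :: "real ^ 'a ^ 'a \<Rightarrow> bool"
  where "diagonal_matrix A \<longleftrightarrow> (\<forall>i j. i \<noteq> j \<longrightarrow> A $ i $ j = 0)"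

definition pos_semidefinite :: "real ^ 'a ^ 'a \<Rightarrow> bool"
  where "pos_semidefinite A \<longleftrightarrow> transpose A = A \<and> (\<forall>v. 0 \<le> v \<bullet> (A *v v))"

definition pos_definite :: "real ^ 'a ^ 'a \<Rightarrow> bool"
  where "pos_definite A \<longleftrightarrow> transpose A = A \<and> (\<forall>v. v \<noteq> 0 \<longrightarrow> 0 < v \<bullet> (A *v v))"

definition loewner_le :: "real ^ 'a ^ 'a \<Rightarrow> real ^ 'a ^ 'a \<Rightarrow> bool"  (infix "\<preceq>" 50)
  where "A \<preceq> B \<longleftrightarrow> pos_semidefinite (B - A)"

text \<open>The spectrum of a real matrix is taken over the complex numbers. It is finite and nonempty,
  so the maximum below is a genuine one.\<close>

definition complex_spectrum :: "real ^ 'a ^ 'a \<Rightarrow> complex set"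
  where "complex_spectrum A = {c. \<exists>v. v \<noteq> 0 \<and> map_matrix complex_of_real A *v v = c *s v}"

definition spectral_radius :: "real ^ 'a ^ 'a \<Rightarrow> real"
  where "spectral_radius A = Max (cmod ` complex_spectrum A)"


section \<open>Nonlinearities\<close>

text \<open>Absolute value and order on vectors and matrices are the componentwise ones of
  \<^theory>\<open>HOL-Analysis.Ordered_Euclidean_Space\<close>.\<close>

definition acts_componentwise :: "(real ^ 'q \<Rightarrow> real ^ 'q) \<Rightarrow> bool"
  where "acts_componentwise \<phi> \<longleftrightarrow> (\<exists>f. \<forall>r i. \<phi> r $ i = f i (r $ i))"

definition componentwise_nonexpansive :: "(real ^ 'q \<Rightarrow> real ^ 'q) \<Rightarrow> bool"
  where "componentwise_nonexpansive \<phi> \<longleftrightarrow>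
    acts_componentwise \<phi> \<and> (\<forall>r s. \<bar>\<phi> r - \<phi> s\<bar> \<le> \<bar>r - s\<bar>)"

text \<open>For a componentwise \<open>\<phi>\<close>, the term \<open>\<phi> r $ i\<close> is the value of the \<open>i\<close>-th scalar function
  at \<open>r $ i\<close>.\<close>

definition incremental_sector ::
  "real ^ 'q ^ 'q \<Rightarrow> real ^ 'q ^ 'q \<Rightarrow> (real ^ 'q \<Rightarrow> real ^ 'q) \<Rightarrow> bool"
  where "incremental_sector D0 D1 \<phi> \<longleftrightarrow>
    diagonal_matrix D0 \<and> diagonal_matrix D1 \<and>
    (\<forall>i. 0 \<le> D0 $ i $ i \<and> D0 $ i $ i \<le> D1 $ i $ i \<and> D1 $ i $ i \<le> 1) \<and>
    (\<forall>r s i. (\<phi> r $ i - \<phi> s $ i - D0 $ i $ i * (r $ i - s $ i)) *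
              (D1 $ i $ i * (r $ i - s $ i) - \<phi> r $ i + \<phi> s $ i) \<ge> 0)"

definition sector_multiplier ::
  "real ^ 'q ^ 'q \<Rightarrow> real ^ 'q ^ 'q \<Rightarrow> real ^ 'k ^ 'q \<Rightarrow> real ^ 'k ^ 'q \<Rightarrow> real ^ 'q ^ 'q
    \<Rightarrow> real ^ 'k ^ 'k"
  where "sector_multiplier D0 D1 Z H \<Lambda> =
    (- 2) *\<^sub>R (transpose Z ** D0 ** \<Lambda> ** D1 ** Z)
    + He (transpose H ** \<Lambda> ** (D0 + D1) ** Z)
    - 2 *\<^sub>R (transpose H ** \<Lambda> ** H)"


section \<open>Closed loop\<close>

definition closed_loop_trajectory ::
  "real ^ 'n ^ 'n \<Rightarrow> real ^ 'm ^ 'n \<Rightarrow> real ^ 'n ^ 'p \<Rightarrow>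
   (real ^ 'q \<Rightarrow> real ^ 'q) \<Rightarrow> real ^ 'q ^ 'q \<Rightarrow> real ^ 'p ^ 'q \<Rightarrow> real ^ 'q \<Rightarrow>
   real ^ 'p ^ 'm \<Rightarrow> real ^ 'q ^ 'm \<Rightarrow> real ^ 'm \<Rightarrow>
   (nat \<Rightarrow> real ^ 'n) \<Rightarrow> (nat \<Rightarrow> real ^ 'p) \<Rightarrow> (nat \<Rightarrow> real ^ 'q) \<Rightarrow> (nat \<Rightarrow> real ^ 'm) \<Rightarrow> bool"
  where "closed_loop_trajectory Ap Bp Cp \<phi> W U b K V d x y \<eta> u \<longleftrightarrow>
    (\<forall>k. x (Suc k) = Ap *v x k + Bp *v u k \<and>
         y k = Cp *v x k \<and>
         \<eta> k = \<phi> (W *v \<eta> k + U *v y k + b) \<and>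
         u k = K *v y k + V *v \<eta> k + d)"

definition closed_loop_equilibrium ::
  "real ^ 'n ^ 'n \<Rightarrow> real ^ 'm ^ 'n \<Rightarrow> real ^ 'n ^ 'p \<Rightarrow>
   (real ^ 'q \<Rightarrow> real ^ 'q) \<Rightarrow> real ^ 'q ^ 'q \<Rightarrow> real ^ 'p ^ 'q \<Rightarrow> real ^ 'q \<Rightarrow>
   real ^ 'p ^ 'm \<Rightarrow> real ^ 'q ^ 'm \<Rightarrow> real ^ 'm \<Rightarrow>
   real ^ 'n \<Rightarrow> real ^ 'p \<Rightarrow> real ^ 'q \<Rightarrow> real ^ 'q \<Rightarrow> real ^ 'm \<Rightarrow> bool"
  where "closed_loop_equilibrium Ap Bp Cp \<phi> W U b K V d xs ys \<eta>s zs us \<longleftrightarrow>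
    xs = Ap *v xs + Bp *v us \<and>
    ys = Cp *v xs \<and>
    zs = W *v \<eta>s + U *v ys + b \<and>
    \<eta>s = \<phi> zs \<and>
    us = K *v ys + V *v \<eta>s + d"

definition globally_exponentially_stable ::
  "(nat \<Rightarrow> 'a::real_normed_vector) set \<Rightarrow> 'a \<Rightarrow> bool"
  where "globally_exponentially_stable T xs \<longleftrightarrow>
    (\<exists>c \<alpha>. 0 < c \<and> 0 \<le> \<alpha> \<and> \<alpha> < 1 \<and>
      (\<forall>x\<in>T. \<forall>k. norm (x k - xs) \<le> c * \<alpha> ^ k * norm (x 0 - xs)))"

end

theory Submission
  imports Defs
begin

text \<open>Written in deviations from the equilibrium, one step of the closed loop is multiplication of
  the stacked vector \<open>(x - xs, \<eta> - \<eta>s)\<close> by \<open>F\<close>, and the argument of \<open>\<phi>\<close> moves by \<open>Z\<close> times that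
  vector. The quadratic form of the multiplier is then twice the \<open>\<Lambda>\<close>-weighted sum of the left-hand
  sides of the sector inequalities, hence nonnegative and removable from the matrix inequality, which
  becomes a dissipation inequality for \<open>x\<^sup>\<top>Px\<close>: a contraction in (i), a telescoping bound in (ii).\<close>

section \<open>Block vectors and quadratic forms\<close>

definition stack :: "real ^ 'a \<Rightarrow> real ^ 'b \<Rightarrow> real ^ ('a + 'b)"
  where "stack a b = (\<chi> j. case j of Inl i \<Rightarrow> a $ i | Inr i \<Rightarrow> b $ i)"

lemma hcat_mult_stack: "hcat A B *v stack a b = A *v a + B *v b"
proof -
  have "(\<Sum>j\<in>UNIV. hcat A B $ i $ j * stack a b $ j)
      = (\<Sum>j\<in>UNIV. A $ i $ j * a $ j) + (\<Sum>j\<in>UNIV. B $ i $ j * b $ j)" for i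
    by (subst UNIV_Plus_UNIV [symmetric], subst sum.Plus) (simp_all add: hcat_def stack_def)
  then show ?thesis
    by (simp add: vec_eq_iff matrix_vector_mult_def)
qed

text \<open>Transposition moves \<open>A\<close> to the other side of the inner product.
  \<open>A\<close> and \<open>B\<close> may differ so that the cross term between \<open>H\<close>
  and \<open>Z\<close> in the multiplier is covered too.\<close>

lemma inner_congruence_form:
  fixes A :: "real ^ 'k ^ 'a" and B :: "real ^ 'k ^ 'b" and M :: "real ^ 'b ^ 'a"
  shows "v \<bullet> ((transpose A ** M ** B) *v v) = (A *v v) \<bullet> (M *v (B *v v))"
proof -
  have "v \<bullet> ((transpose A ** M ** B) *v v) = v \<bullet> (transpose A *v (M *v (B *v v)))"
    by (simp add: matrix_vector_mul_assoc matrix_mul_assoc)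
  also have "\<dots> = (A *v v) \<bullet> (M *v (B *v v))"
    by (metis dot_lmul_matrix vector_transpose_matrix)
  finally show ?thesis .
qed

lemma inner_He_form: "v \<bullet> (He Y *v v) = 2 * (v \<bullet> (Y *v v))"
proof -
  have "v \<bullet> (transpose Y *v v) = v \<bullet> (Y *v v)"
    by (metis dot_lmul_matrix inner_commute transpose_matrix_vector)
  then show ?thesis
    by (simp add: He_def matrix_vector_mult_add_rdistrib inner_add_right)
qed

lemma diagonal_matrix_mult_vec:
  assumes "diagonal_matrix A"
  shows "(A *v v) $ i = A $ i $ i * v $ i"
proof -
  have "(\<Sum>j\<in>UNIV. A $ i $ j * v $ j) = (\<Sum>j\<in>UNIV. if i = j then A $ i $ i * v $ i else 0)"
    using assms by (intro sum.cong) (auto simp: diagonal_matrix_def)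
  then show ?thesis
    by (simp add: matrix_vector_mult_def)
qed

text \<open>The quadratic form at the \<open>i\<close>-th unit vector is the \<open>i\<close>-th
  diagonal entry.\<close>

lemma diagonal_psd_nonneg:
  assumes "diagonal_matrix A" "0 \<preceq> A"
  shows "0 \<le> A $ i $ i"
proof -
  have "0 \<le> axis i 1 \<bullet> (A *v axis i 1)"
    using assms(2) by (simp add: loewner_le_def pos_semidefinite_def)
  then show ?thesis
    by (simp add: inner_axis' diagonal_matrix_mult_vec [OF assms(1)])
qed

lemma loewner_le_zero_form: "A \<preceq> 0 \<Longrightarrow> v \<bullet> (A *v v) \<le> 0"
proof -
  assume "A \<preceq> 0"
  then have "0 \<le> v \<bullet> ((0 - A) *v v)"
    by (simp only: loewner_le_def pos_semidefinite_def)
  then show ?thesis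
    by (simp only: matrix_vector_mult_diff_rdistrib) simp
qed

lemma loewner_ge_zero_form: "0 \<preceq> A \<Longrightarrow> 0 \<le> v \<bullet> (A *v v)"
  by (simp add: loewner_le_def pos_semidefinite_def)

section \<open>The sector multiplier\<close>

text \<open>Diagonal weights split each of the three terms into a sum over coordinates. In one
  coordinate, with \<open>D0\<close>, \<open>D1\<close> entries \<open>l\<close>, \<open>u\<close>,
  the terms add up to \<open>- l u z^2 + (l + u) h z - h^2\<close>, which factors as
  \<open>(h - l z) (u z - h)\<close>.\<close>

lemma sector_multiplier_form:
  fixes \<Lambda> :: "real ^ 'q ^ 'q"
  assumes "diagonal_matrix D0" "diagonal_matrix D1" "diagonal_matrix \<Lambda>"
  shows "v \<bullet> (sector_multiplier D0 D1 Z H \<Lambda> *v v)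
    = 2 * (\<Sum>i\<in>UNIV. \<Lambda> $ i $ i * (((H *v v) $ i - D0 $ i $ i * (Z *v v) $ i)
                                * (D1 $ i $ i * (Z *v v) $ i - (H *v v) $ i)))"
proof -
  let ?z = "Z *v v" and ?h = "H *v v"
  have "v \<bullet> (sector_multiplier D0 D1 Z H \<Lambda> *v v)
    = - 2 * (?z \<bullet> ((D0 ** \<Lambda> ** D1) *v ?z)) + 2 * (?h \<bullet> ((\<Lambda> ** (D0 + D1)) *v ?z))
      - 2 * (?h \<bullet> (\<Lambda> *v ?h))"
    using inner_congruence_form [of v Z "D0 ** \<Lambda> ** D1" Z]
      inner_congruence_form [of v H "\<Lambda> ** (D0 + D1)" Z] inner_congruence_form [of v H \<Lambda> H]
    by (simp add: sector_multiplier_def matrix_vector_mult_add_rdistrib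
        matrix_vector_mult_diff_rdistrib scaleR_matrix_vector_assoc [symmetric] inner_add_right
        inner_diff_right inner_He_form matrix_mul_assoc)
  also have "\<dots> = 2 * (- (\<Sum>i\<in>UNIV. ?z $ i * (D0 $ i $ i * (\<Lambda> $ i $ i * (D1 $ i $ i * ?z $ i))))
      + (\<Sum>i\<in>UNIV. ?h $ i * (\<Lambda> $ i $ i * (D0 $ i $ i * ?z $ i + D1 $ i $ i * ?z $ i)))
      - (\<Sum>i\<in>UNIV. ?h $ i * (\<Lambda> $ i $ i * ?h $ i)))"
    by (simp add: inner_vec_def matrix_vector_mul_assoc [symmetric]
        matrix_vector_mult_add_rdistrib diagonal_matrix_mult_vec assms)
  also have "\<dots> = 2 * (\<Sum>i\<in>UNIV. \<Lambda> $ i $ i * ((?h $ i - D0 $ i $ i * ?z $ i)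
                                * (D1 $ i $ i * ?z $ i - ?h $ i)))"
    unfolding sum_negf [symmetric] sum.distrib [symmetric] sum_subtractf [symmetric]
    by (intro arg_cong [where f = "\<lambda>t. 2 * t"] sum.cong) (simp_all add: algebra_simps)
  finally show ?thesis .
qed

text \<open>With \<open>Z *v v\<close> the change in the argument of \<open>\<phi>\<close> and
  \<open>H *v v\<close> the change in its value, each factored summand is a sector product with a
  nonnegative weight.\<close>

lemma sector_multiplier_form_nonneg:
  assumes "incremental_sector D0 D1 \<phi>" "diagonal_matrix \<Lambda>" "0 \<preceq> \<Lambda>"
    and "Z *v v = r - s" "H *v v = \<phi> r - \<phi> s"
  shows "0 \<le> v \<bullet> (sector_multiplier D0 D1 Z H \<Lambda> *v v)"
proof -
  have diag: "diagonal_matrix D0" "diagonal_matrix D1"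
    using assms(1) by (simp_all add: incremental_sector_def)
  have "0 \<le> ((\<phi> r - \<phi> s) $ i - D0 $ i $ i * (r - s) $ i)
          * (D1 $ i $ i * (r - s) $ i - (\<phi> r - \<phi> s) $ i)" for i
  proof -
    have "0 \<le> (\<phi> r $ i - \<phi> s $ i - D0 $ i $ i * (r $ i - s $ i)) *
              (D1 $ i $ i * (r $ i - s $ i) - \<phi> r $ i + \<phi> s $ i)"
      using assms(1) by (simp add: incremental_sector_def)
    then show ?thesis by (simp add: algebra_simps)
  qed
  then show ?thesis
    unfolding sector_multiplier_form [OF diag assms(2)] assms(4,5)
    using diagonal_psd_nonneg [OF assms(2,3)]
    by (intro mult_nonneg_nonneg [of 2] sum_nonneg mult_nonneg_nonneg [of "\<Lambda> $ _ $ _"]) simp_all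
qed

section \<open>Norm bounds and discounted sums\<close>

text \<open>The form is continuous, so it attains its extrema on the compact unit sphere. They are
  positive there, and homogeneity of degree two carries the bounds to all vectors.\<close>

lemma pos_definite_form_bounds:
  fixes P :: "real ^ 'n ^ 'n"
  assumes "pos_definite P"
  obtains a c where "0 < a" "0 < c"
    "\<And>v. a * (norm v)\<^sup>2 \<le> v \<bullet> (P *v v)" "\<And>v. v \<bullet> (P *v v) \<le> c * (norm v)\<^sup>2"
proof -
  let ?q = "\<lambda>v. v \<bullet> (P *v v)" and ?S = "sphere (0 :: real ^ 'n) 1"
  have cont: "continuous_on ?S ?q"
    by (intro continuous_intros linear_continuous_on)
      (simp add: linear_conv_bounded_linear [symmetric])
  have "axis undefined 1 \<in> ?S"
    by (simp add: norm_axis_1)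
  then have ne: "?S \<noteq> {}" by blast
  obtain m where m: "m \<in> ?S" "\<And>v. v \<in> ?S \<Longrightarrow> ?q m \<le> ?q v"
    using continuous_attains_inf [OF compact_sphere ne cont] by blast
  obtain M where M: "M \<in> ?S" "\<And>v. v \<in> ?S \<Longrightarrow> ?q v \<le> ?q M"
    using continuous_attains_sup [OF compact_sphere ne cont] by blast
  have "m \<noteq> 0" "M \<noteq> 0"
    using m(1) M(1) by auto
  then have pos: "0 < ?q m" "0 < ?q M"
    using assms by (simp_all add: pos_definite_def)
  have hom: "?q v = ?q (v /\<^sub>R norm v) * (norm v)\<^sup>2" if "v \<noteq> 0" for v
    using that by (simp add: matrix_vector_mult_scaleR power2_eq_square field_simps)
  have sph: "v /\<^sub>R norm v \<in> ?S" if "v \<noteq> 0" for v :: "real ^ 'n"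
    using that by simp
  have "?q m * (norm v)\<^sup>2 \<le> ?q v" and "?q v \<le> ?q M * (norm v)\<^sup>2" for v
  proof -
    show "?q m * (norm v)\<^sup>2 \<le> ?q v"
    proof (cases "v = 0")
      case False
      then show ?thesis
        using mult_right_mono [OF m(2) [OF sph [OF False]], of "(norm v)\<^sup>2"]
        unfolding hom [OF False, symmetric] by simp
    qed simp
    show "?q v \<le> ?q M * (norm v)\<^sup>2"
    proof (cases "v = 0")
      case False
      then show ?thesis
        using mult_right_mono [OF M(2) [OF sph [OF False]], of "(norm v)\<^sup>2"]
        unfolding hom [OF False, symmetric] by simp
    qed simp
  qed
  with pos show thesis by (rule that)
qed

text \<open>Weighting the \<open>k\<close>-th inequality by \<open>\<beta> ^ k\<close> makes the
  \<open>v\<close> terms telescope. The remainder \<open>\<beta> ^ N * v N\<close> is nonnegative,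
  so \<open>v 0\<close> bounds all partial sums of a nonnegative series.\<close>

lemma discounted_dissipation_sum:
  fixes s v :: "nat \<Rightarrow> real"
  assumes "0 < \<beta>" "\<And>k. 0 \<le> s k" "\<And>k. 0 \<le> v k" "\<And>k. \<beta> * v (Suc k) - v k + s k \<le> 0"
  shows "summable (\<lambda>k. \<beta> ^ k * s k)" "(\<Sum>k. \<beta> ^ k * s k) \<le> v 0"
proof -
  have telescope: "(\<Sum>k<N. \<beta> ^ k * s k) \<le> v 0 - \<beta> ^ N * v N" for N
  proof (induction N)
    case (Suc N)
    have "\<beta> ^ N * (\<beta> * v (Suc N) - v N + s N) \<le> 0"
      using assms(1,4) by (intro mult_nonneg_nonpos) auto
    with Suc show ?case by (simp add: algebra_simps)
  qed simp
  have bound: "(\<Sum>k<N. \<beta> ^ k * s k) \<le> v 0" for N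
  proof -
    have "0 \<le> \<beta> ^ N * v N" using assms(1,3) by simp
    with telescope [of N] show ?thesis by linarith
  qed
  have nonneg: "0 \<le> \<beta> ^ k * s k" for k
    using assms(1,2) by simp
  show "summable (\<lambda>k. \<beta> ^ k * s k)"
    by (intro summableI_nonneg_bounded [where x = "v 0"] nonneg bound)
  then show "(\<Sum>k. \<beta> ^ k * s k) \<le> v 0"
    using bound by (rule suminf_le_const)
qed

section \<open>Stability and guaranteed cost of the closed loop\<close>

theorem theorem5:
  fixes Ap :: "real ^ 'n ^ 'n" and Bp :: "real ^ 'm ^ 'n" and Cp :: "real ^ 'n ^ 'p"
    and \<phi> :: "real ^ 'q \<Rightarrow> real ^ 'q"
    and W :: "real ^ 'q ^ 'q" and U :: "real ^ 'p ^ 'q" and b :: "real ^ 'q"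
    and K :: "real ^ 'p ^ 'm" and V :: "real ^ 'q ^ 'm" and d :: "real ^ 'm"
    and xs :: "real ^ 'n" and ys :: "real ^ 'p" and \<eta>s zs :: "real ^ 'q" and us :: "real ^ 'm"
    and D0 D1 :: "real ^ 'q ^ 'q"
    and X :: "real ^ ('n + 'q) ^ 'n" and H :: "real ^ ('n + 'q) ^ 'q"
    and Z :: "real ^ ('n + 'q) ^ 'q" and F :: "real ^ ('n + 'q) ^ 'n"
    and G :: "real ^ ('n + 'q) ^ 'm"
  assumes X: "X = hcat (mat 1) 0"
    and H: "H = hcat 0 (mat 1)"
    and Z: "Z = hcat (U ** Cp) W"
    and F: "F = hcat (Ap + Bp ** K ** Cp) (Bp ** V)"
    and G: "G = hcat (K ** Cp) V"
    and equilibrium: "closed_loop_equilibrium Ap Bp Cp \<phi> W U b K V d xs ys \<eta>s zs us"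
    and nonexpansive: "componentwise_nonexpansive \<phi>"
    and sector: "incremental_sector D0 D1 \<phi>"
    and pf: "spectral_radius \<bar>W\<bar> < 1"
  shows
    "(\<forall>P \<Lambda> \<rho>.
        pos_definite P \<and> diagonal_matrix \<Lambda> \<and> 0 \<preceq> \<Lambda> \<and> 0 \<le> \<rho> \<and> \<rho> < 1 \<and>
        transpose F ** P ** F - \<rho>\<^sup>2 *\<^sub>R (transpose X ** P ** X)
          + sector_multiplier D0 D1 Z H \<Lambda> \<preceq> 0 \<longrightarrow>
        globally_exponentially_stable
          {x. \<exists>y \<eta> u. closed_loop_trajectory Ap Bp Cp \<phi> W U b K V d x y \<eta> u} xs \<and>
        (\<forall>x y \<eta> u. closed_loop_trajectory Ap Bp Cp \<phi> W U b K V d x y \<eta> u \<longrightarrow>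
          (\<forall>k. (x k - xs) \<bullet> (P *v (x k - xs)) \<le> \<rho> ^ (2 * k) * ((x 0 - xs) \<bullet> (P *v (x 0 - xs))))))
     \<and>
     (\<forall>Q R \<beta> P \<Lambda>.
        0 \<preceq> Q \<and> 0 \<preceq> R \<and> 0 < \<beta> \<and> \<beta> \<le> 1 \<and>
        pos_definite P \<and> diagonal_matrix \<Lambda> \<and> 0 \<preceq> \<Lambda> \<and>
        \<beta> *\<^sub>R (transpose F ** P ** F) - transpose X ** P ** X
          + transpose X ** Q ** X + transpose G ** R ** G
          + sector_multiplier D0 D1 Z H \<Lambda> \<preceq> 0 \<longrightarrow>
        (\<forall>x y \<eta> u. closed_loop_trajectory Ap Bp Cp \<phi> W U b K V d x y \<eta> u \<longrightarrow>
          (let stage_cost = \<lambda>k. \<beta> ^ k * ((x k - xs) \<bullet> (Q *v (x k - xs)) + (u k - us) \<bullet> (R *v (u k - us)))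
           in summable stage_cost \<and> (\<Sum>k. stage_cost k) \<le> (x 0 - xs) \<bullet> (P *v (x 0 - xs)))))"
proof -
  define w where "w x \<eta> = stack (x - xs) (\<eta> - \<eta>s)" for x \<eta>
  note eq = equilibrium [unfolded closed_loop_equilibrium_def]
  note lin = matrix_vector_mult_diff_distrib matrix_vector_right_distrib
    matrix_vector_mult_add_rdistrib matrix_vector_mul_assoc [symmetric]
  have Xw: "X *v w x \<eta> = x - xs" for x \<eta>
    by (simp add: X w_def hcat_mult_stack)
  have Hw: "H *v w x \<eta> = \<eta> - \<eta>s" for x \<eta>
    by (simp add: H w_def hcat_mult_stack)
  \<comment> \<open>One time step in deviation coordinates, for an arbitrary trajectory: the images
    under \<open>F\<close> and \<open>G\<close>, and the sign of the multiplier form.\<close>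
  {
    fix x y \<eta> u and k :: nat
    assume "closed_loop_trajectory Ap Bp Cp \<phi> W U b K V d x y \<eta> u"
    note tr = this [unfolded closed_loop_trajectory_def, rule_format, of k]
    have y: "y k = Cp *v x k" and u: "u k = K *v y k + V *v \<eta> k + d"
      and x: "x (Suc k) = Ap *v x k + Bp *v u k"
      and \<eta>: "\<eta> k = \<phi> (W *v \<eta> k + U *v y k + b)"
      using tr by blast+
    have ys: "ys = Cp *v xs" and us: "us = K *v ys + V *v \<eta>s + d"
      and xs: "xs = Ap *v xs + Bp *v us"
      and zs: "zs = W *v \<eta>s + U *v ys + b" and \<eta>s: "\<eta>s = \<phi> zs"
      using eq by blast+
    have Gw: "G *v w (x k) (\<eta> k) = u k - us"
      unfolding u us y ys by (simp add: G w_def hcat_mult_stack lin)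
    \<comment> \<open>\<open>F\<close> is the block row \<open>[Ap 0]\<close> plus
      \<open>Bp ** G\<close>, so the input deviation found above can be substituted.\<close>
    have "F *v w (x k) (\<eta> k) = Ap *v (x k - xs) + Bp *v (G *v w (x k) (\<eta> k))"
      by (simp add: F G w_def hcat_mult_stack lin)
    also have "\<dots> = (Ap *v x k + Bp *v u k) - (Ap *v xs + Bp *v us)"
      by (simp add: Gw lin)
    finally have Fw: "F *v w (x k) (\<eta> k) = x (Suc k) - xs"
      by (simp only: x [symmetric] xs [symmetric])
    \<comment> \<open>The bias \<open>b\<close> occurs in both arguments of \<open>\<phi>\<close>
      and cancels.\<close>
    have Zw: "Z *v w (x k) (\<eta> k) = (W *v \<eta> k + U *v y k + b) - zs"
      unfolding zs y ys by (simp add: Z w_def hcat_mult_stack lin)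
    have "H *v w (x k) (\<eta> k) = \<phi> (W *v \<eta> k + U *v y k + b) - \<phi> zs"
      unfolding Hw by (simp only: \<eta> [symmetric] \<eta>s [symmetric])
    note Fw Gw sector_multiplier_form_nonneg [OF sector _ _ Zw this]
  } note step = this
  note form = matrix_vector_mult_add_rdistrib matrix_vector_mult_diff_rdistrib
    scaleR_matrix_vector_assoc [symmetric] inner_add_right inner_diff_right inner_congruence_form Xw
  have decay: "(x k - xs) \<bullet> (P *v (x k - xs)) \<le> \<rho> ^ (2 * k) * ((x 0 - xs) \<bullet> (P *v (x 0 - xs)))"
    if \<Lambda>: "diagonal_matrix \<Lambda>" "0 \<preceq> \<Lambda>"
      and lmi: "transpose F ** P ** F - \<rho>\<^sup>2 *\<^sub>R (transpose X ** P ** X)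
        + sector_multiplier D0 D1 Z H \<Lambda> \<preceq> 0"
      and tr: "closed_loop_trajectory Ap Bp Cp \<phi> W U b K V d x y \<eta> u"
    for P \<Lambda> \<rho> x y \<eta> u k
  proof (induction k)
    case (Suc k)
    \<comment> \<open>The matrix inequality at the stacked deviation, with the nonnegative
      multiplier term dropped.\<close>
    have "(x (Suc k) - xs) \<bullet> (P *v (x (Suc k) - xs)) \<le> \<rho>\<^sup>2 * ((x k - xs) \<bullet> (P *v (x k - xs)))"
      using loewner_le_zero_form [OF lmi, of "w (x k) (\<eta> k)"] step(3) [OF tr \<Lambda>, of k]
      by (simp add: form step(1) [OF tr])
    also have "\<dots> \<le> \<rho>\<^sup>2 * (\<rho> ^ (2 * k) * ((x 0 - xs) \<bullet> (P *v (x 0 - xs))))"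
      by (intro mult_left_mono Suc) simp
    finally show ?case
      by (simp add: power2_eq_square mult.assoc)
  qed simp
  have stable: "globally_exponentially_stable T xs"
    if P: "pos_definite P" and \<rho>: "0 \<le> \<rho>" "\<rho> < 1"
      and T: "\<And>x k. x \<in> T \<Longrightarrow>
        (x k - xs) \<bullet> (P *v (x k - xs)) \<le> \<rho> ^ (2 * k) * ((x 0 - xs) \<bullet> (P *v (x 0 - xs)))"
    for P \<rho> T
  proof -
    obtain a c where ac: "0 < a" "0 < c"
      and lower: "\<And>v. a * (norm v)\<^sup>2 \<le> v \<bullet> (P *v v)"
      and upper: "\<And>v. v \<bullet> (P *v v) \<le> c * (norm v)\<^sup>2"
      using pos_definite_form_bounds [OF P] by blast
    \<comment> \<open>The constant comes from comparing squares: \<open>a\<close> times the squared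
      norm at time \<open>k\<close> is at most \<open>\<rho> ^ (2 * k) * c\<close> times the initial
      one.\<close>
    have "norm (x k - xs) \<le> sqrt (c / a) * \<rho> ^ k * norm (x 0 - xs)" if "x \<in> T" for x k
    proof (rule power2_le_imp_le)
      have "a * (norm (x k - xs))\<^sup>2 \<le> \<rho> ^ (2 * k) * ((x 0 - xs) \<bullet> (P *v (x 0 - xs)))"
        using lower T [OF that] by (rule order_trans)
      also have "\<dots> \<le> \<rho> ^ (2 * k) * (c * (norm (x 0 - xs))\<^sup>2)"
        using \<rho> by (intro mult_left_mono upper) simp
      finally show "(norm (x k - xs))\<^sup>2 \<le> (sqrt (c / a) * \<rho> ^ k * norm (x 0 - xs))\<^sup>2"
        using ac by (simp add: power_mult_distrib field_simps flip: power_mult)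
    qed (use ac \<rho> in simp)
    then show ?thesis
      unfolding globally_exponentially_stable_def using ac \<rho>
      by (intro exI [of _ "sqrt (c / a)"] exI [of _ \<rho>]) auto
  qed
  have cost: "summable (\<lambda>k. \<beta> ^ k * ((x k - xs) \<bullet> (Q *v (x k - xs)) + (u k - us) \<bullet> (R *v (u k - us))))
      \<and> (\<Sum>k. \<beta> ^ k * ((x k - xs) \<bullet> (Q *v (x k - xs)) + (u k - us) \<bullet> (R *v (u k - us))))
        \<le> (x 0 - xs) \<bullet> (P *v (x 0 - xs))"
    if QR: "0 \<preceq> Q" "0 \<preceq> R" and \<beta>: "0 < \<beta>" and P: "pos_definite P"
      and \<Lambda>: "diagonal_matrix \<Lambda>" "0 \<preceq> \<Lambda>"
      and lmi: "\<beta> *\<^sub>R (transpose F ** P ** F) - transpose X ** P ** X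
          + transpose X ** Q ** X + transpose G ** R ** G
          + sector_multiplier D0 D1 Z H \<Lambda> \<preceq> 0"
      and tr: "closed_loop_trajectory Ap Bp Cp \<phi> W U b K V d x y \<eta> u"
    for Q R \<beta> P \<Lambda> x y \<eta> u
  proof -
    let ?s = "\<lambda>k. (x k - xs) \<bullet> (Q *v (x k - xs)) + (u k - us) \<bullet> (R *v (u k - us))"
      and ?v = "\<lambda>k. (x k - xs) \<bullet> (P *v (x k - xs))"
    have s: "0 \<le> ?s k" for k
      by (intro add_nonneg_nonneg loewner_ge_zero_form QR)
    \<comment> \<open>\<open>pos_definite\<close> speaks only of nonzero vectors, so a zero
      deviation is treated separately.\<close>
    have v: "0 \<le> ?v k" for k
      using P by (cases "x k - xs = 0") (auto simp only: pos_definite_def inner_zero_left intro: less_imp_le)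
    \<comment> \<open>At the stacked deviation, the \<open>Q\<close> term of the matrix inequality
      becomes the state cost through \<open>X\<close>, and the \<open>R\<close> term the input cost
      through \<open>G\<close>.\<close>
    have "\<beta> * ?v (Suc k) - ?v k + ?s k \<le> 0" for k
      using loewner_le_zero_form [OF lmi, of "w (x k) (\<eta> k)"] step(3) [OF tr \<Lambda>, of k]
      by (simp add: form step(1,2) [OF tr])
    with discounted_dissipation_sum [of \<beta> ?s ?v] \<beta> s v show ?thesis by blast
  qed
  show ?thesis
    unfolding Let_def
  \<comment> \<open>The instance of \<open>conjI\<close> splits only the outer conjunction of two
    universal statements; the conjunctions under the quantifiers stay whole.\<close>
  proof (intro conjI [of "All _" "All _"] allI impI; elim conjE)
    fix P \<Lambda> \<rho>
    assume P: "pos_definite P" and \<rho>: "0 \<le> \<rho>" "\<rho> < 1"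
      and \<Lambda>: "diagonal_matrix \<Lambda>" "0 \<preceq> \<Lambda>"
      and lmi: "transpose F ** P ** F - \<rho>\<^sup>2 *\<^sub>R (transpose X ** P ** X)
        + sector_multiplier D0 D1 Z H \<Lambda> \<preceq> 0"
    note decay = decay [OF \<Lambda> lmi]
    show "globally_exponentially_stable
          {x. \<exists>y \<eta> u. closed_loop_trajectory Ap Bp Cp \<phi> W U b K V d x y \<eta> u} xs \<and>
        (\<forall>x y \<eta> u. closed_loop_trajectory Ap Bp Cp \<phi> W U b K V d x y \<eta> u \<longrightarrow>
          (\<forall>k. (x k - xs) \<bullet> (P *v (x k - xs)) \<le> \<rho> ^ (2 * k) * ((x 0 - xs) \<bullet> (P *v (x 0 - xs)))))"
    proof (intro conjI allI impI)
      show "globally_exponentially_stable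
          {x. \<exists>y \<eta> u. closed_loop_trajectory Ap Bp Cp \<phi> W U b K V d x y \<eta> u} xs"
        by (rule stable [OF P \<rho>]) (use decay in blast)
    qed (rule decay)
  qed (rule cost)
qed

end
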